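(* Let $(\mathcal{P}=P_1\oplus P_2,\odot,\{\!\!\{~,~\}\!\!\})$ be a proto-twilled Poisson algebra over a field $\mathbf{k}$ of characteristic $0$, with structure maps $\cdot_1,\cdot_2,\mu,\nu,h,\theta,\{~,~\}_1,\{~,~\}_2,\rho,\psi,H,\Theta$, in which $\psi=0$. Let $r:P_2\to P_1$ be a deformation map such that $Z^1((P_2)_r,P_1)=\delta^r_{\mathrm{FGV}}(\mathrm{Nij}(r))$, where $Z^1((P_2)_r,P_1)$ is the set of all $1$-cocycles in the cochain complex associated with $r$ and $\mathrm{Nij}(r)\subset P_1$ is the set of Nijenhuis elements associated with $r$. Then $r$ is rigid.
   Context: A Poisson algebra is a vector space with a commutative associative product and a Lie bracket such that the bracket satisfies the Leibniz rule $\{x,yz\}=\{x,y\}z+y\{x,z\}$. A proto-twilled Poisson algebra is a Poisson algebra $(\mathcal{P},\odot,\{\!\!\{~,~\}\!\!\})$ whose underlying vector space has a direct sum decomposition $\mathcal{P}=P_1\oplus P_2$ into subspaces (not necessarily subalgebras). Its structure maps are the (bi)linear maps $\cdot_1:P_1\times P_1\to P_1$, $\cdot_2:P_2\times P_2\to P_2$, $h:P_1\times P_1\to P_2$, $\theta:P_2\times P_2\to P_1$ (symmetric), $\{~,~\}_1:P_1\times P_1\to P_1$, $\{~,~\}_2:P_2\times P_2\to P_2$, $H:P_1\times P_1\to P_2$, $\Theta:P_2\times P_2\to P_1$ (antisymmetric), $\mu,\rho:P_1\to\mathrm{End}(P_2)$, $\nu,\psi:P_2\to\mathrm{End}(P_1)$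 uniquely determined by $$(x,u)\odot(y,v)=\big(x\cdot_1y+\nu_uy+\nu_vx+\theta(u,v),\ u\cdot_2v+\mu_xv+\mu_yu+h(x,y)\big),$$ $$\{\!\!\{(x,u),(y,v)\}\!\!\}=\big(\{x,y\}_1+\psi_uy-\psi_vx+\Theta(u,v),\ \{u,v\}_2+\rho_xv-\rho_yu+H(x,y)\big).$$ A linear map $r:P_2\to P_1$ is a deformation map if its graph $\{(r(u),u)\mid u\in P_2\}$ is a Poisson subalgebra of $\mathcal{P}$. Cohomology of $r$ in low degree: put $u\cdot_rv=u\cdot_2v+\mu_{r(u)}v+\mu_{r(v)}u+h(r(u),r(v))$, $\{u,v\}_r=\{u,v\}_2+\rho_{r(u)}v-\rho_{r(v)}u+H(r(u),r(v))$, a Poisson algebra structure on $P_2$ denoted $(P_2)_r$, with representation on $P_1$ given by $(\nu_r)_ux=\nu_ux+r(u)\cdot_1x-r(\mu_xu+h(r(u),x))$ and $(\psi_r)_ux=\psi_ux+\{r(u),x\}_1-r(-\rho_xu+H(r(u),x))$. The cochain complex associated with $r$ is the Flato-Gerstenhaber-Voronov complex of $(P_2)_r$ with coefficients in $(P_1,\nu_r,\psi_r)$. In degrees $0$ and $1$: $0$-cochains are elements $x\in P_1$, with $\delta^r_{\mathrm{FGV}}(x)(u)=(\psi_r)_ux$; $1$-cochains are linear maps $f:P_2\to P_1$, and $f$ is a $1$-cocycle iff for all $u,v\in P_2$, $f(u\cdot_rv)=(\nu_r)_uf(v)+(\nu_r)_vf(u)$ and $f(\{u,v\}_r)=(\psi_r)_uf(v)-(\psi_r)_vf(u)$.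 Nijenhuis elements: $x_0\in P_1$ is a Nijenhuis element associated with $r$ if for every $t\in\mathbf{k}$ the map $P_1\oplus P_2\to P_1\oplus P_2$, $(x,u)\mapsto\big(x+t\{x_0,x\}_1,\ u+t(\rho_{x_0}u+H(x_0,r(u)))\big)$ is a Poisson algebra homomorphism and moreover $\big\{\{r(u),x_0\}_1-r(-\rho_{x_0}u+H(r(u),x_0)),\,x_0\big\}_1=0$ for all $u\in P_2$. A formal one-parameter deformation of $r$ is a formal power series $r_t=\sum_{i\ge0}t^ir_i\in\mathrm{Hom}(P_2,P_1)[[t]]$ with $r_0=r$ whose $\mathbf{k}[[t]]$-linear extension $r_t:P_2[[t]]\to P_1[[t]]$ is a deformation map in $\mathcal{P}[[t]]\cong P_1[[t]]\oplus P_2[[t]]$, with $\odot,\{\!\!\{~,~\}\!\!\}$ extended $\mathbf{k}[[t]]$-bilinearly. A homomorphism from a deformation map $r$ to a deformation map $r'$ (in the same proto-twilled Poisson algebra) is a pair of linear maps $\varphi_1:P_1\to P_1$, $\varphi_2:P_2\to P_2$ such that $\varphi_1\oplus\varphi_2$ is a Poisson algebra homomorphism of $P_1\oplus P_2$ and $\varphi_1\circ r=r'\circ\varphi_2$ (similarly over $\mathbf{k}[[t]]$). Two formal one-parameter deformations $r_t$, $r'_t$ of $r$ are equivalent if there exist $x_0\in P_1$ and linear maps $\varphi_{1,i}:P_1\to P_1$, $\varphi_{2,i}:P_2\to P_2$ ($i\ge2$) such that the pair $$\varphi_{1,t}=\mathrm{id}_{P_1}+t\{x_0,-\}_1+\sum_{i\ge2}t^i\varphi_{1,i},\qquad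 \varphi_{2,t}=\mathrm{id}_{P_2}+t\big(\rho_{x_0}+H(x_0,r(-))\big)+\sum_{i\ge2}t^i\varphi_{2,i}$$ is a homomorphism of deformation maps (over $\mathbf{k}[[t]]$, in $\mathcal{P}[[t]]$) from $r_t$ to $r'_t$. $r$ is rigid if every formal one-parameter deformation $r_t$ of $r$ is equivalent to the undeformed one $r'_t=r$. *)

theory Defs
  imports "HOL-Computational_Algebra.Formal_Power_Series" "HOL-Library.Product_Plus"
begin

unbundle fps_syntax

section \<open>Poisson algebras\<close>

text \<open>Scalars range over a commutative ring, because the base \<open>k\<close> and the base \<open>k[[t]]\<close> are both
  needed. Over a field, the locale \<^locale>\<open>module\<close> is \<^locale>\<open>vector_space\<close>.\<close>

locale poisson_algebra = module scale
  for scale :: "'k::comm_ring_1 \<Rightarrow> 'p::ab_group_add \<Rightarrow> 'p" +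
  fixes mult :: "'p \<Rightarrow> 'p \<Rightarrow> 'p"
    and brk :: "'p \<Rightarrow> 'p \<Rightarrow> 'p"
  assumes mult_linear_right: "module_hom scale scale (\<lambda>y. mult x y)"
    and mult_linear_left: "module_hom scale scale (\<lambda>x. mult x y)"
    and mult_commute: "mult x y = mult y x"
    and mult_assoc: "mult (mult x y) z = mult x (mult y z)"
    and brk_linear_right: "module_hom scale scale (\<lambda>y. brk x y)"
    and brk_linear_left: "module_hom scale scale (\<lambda>x. brk x y)"
    and brk_self: "brk x x = 0"
    and jacobi: "brk x (brk y z) + brk y (brk z x) + brk z (brk x y) = 0"
    and leibniz: "brk x (mult y z) = mult (brk x y) z + mult y (brk x z)"
begin

definition poisson_subalgebra :: "'p set \<Rightarrow> bool" where
  "poisson_subalgebra S \<longleftrightarrow>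
     subspace S \<and> (\<forall>x\<in>S. \<forall>y\<in>S. mult x y \<in> S) \<and> (\<forall>x\<in>S. \<forall>y\<in>S. brk x y \<in> S)"

definition poisson_endomorphism :: "('p \<Rightarrow> 'p) \<Rightarrow> bool" where
  "poisson_endomorphism f \<longleftrightarrow>
     module_hom scale scale f \<and>
     (\<forall>x y. f (mult x y) = mult (f x) (f y)) \<and>
     (\<forall>x y. f (brk x y) = brk (f x) (f y))"

lemma brk_antisym: "brk x y = - brk y x"
proof -
  have "brk (x + y) (x + y) = brk x y + brk y x"
    using brk_self[of x] brk_self[of y]
    by (simp add: module_hom.add[OF brk_linear_right] module_hom.add[OF brk_linear_left])
  then show ?thesis
    using brk_self[of "x + y"] by (simp add: eq_neg_iff_add_eq_0)
qed

end

section \<open>Proto-twilled Poisson algebras\<close>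

definition prod_scale ::
    "('k \<Rightarrow> 'a \<Rightarrow> 'a) \<Rightarrow> ('k \<Rightarrow> 'b \<Rightarrow> 'b) \<Rightarrow> 'k \<Rightarrow> 'a \<times> 'b \<Rightarrow> 'a \<times> 'b" where
  "prod_scale s1 s2 c = map_prod (s1 c) (s2 c)"

text \<open>The direct sum \<open>P\<^sub>1 \<oplus> P\<^sub>2\<close> is the product type \<open>'a \<times> 'b\<close>; nothing is assumed about
  \<open>P\<^sub>1 \<times> 0\<close> and \<open>0 \<times> P\<^sub>2\<close> being closed under the operations.\<close>

locale proto_twilled_poisson =
  P1: module s1 + P2: module s2 + poisson_algebra "prod_scale s1 s2" mult brk
  for s1 :: "'k::comm_ring_1 \<Rightarrow> 'a::ab_group_add \<Rightarrow> 'a"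
    and s2 :: "'k \<Rightarrow> 'b::ab_group_add \<Rightarrow> 'b"
    and mult :: "'a \<times> 'b \<Rightarrow> 'a \<times> 'b \<Rightarrow> 'a \<times> 'b"
    and brk :: "'a \<times> 'b \<Rightarrow> 'a \<times> 'b \<Rightarrow> 'a \<times> 'b"
begin

subsection \<open>Structure maps\<close>

text \<open>The structure maps are the components of the two operations; \<open>mult_components\<close> and
  \<open>brk_components\<close> below are their defining expansions.\<close>

definition dot1 :: "'a \<Rightarrow> 'a \<Rightarrow> 'a" where "dot1 x y = fst (mult (x, 0) (y, 0))"
definition dot2 :: "'b \<Rightarrow> 'b \<Rightarrow> 'b" where "dot2 u v = snd (mult (0, u) (0, v))"
definition h :: "'a \<Rightarrow> 'a \<Rightarrow> 'b" where "h x y = snd (mult (x, 0) (y, 0))"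
definition \<theta> :: "'b \<Rightarrow> 'b \<Rightarrow> 'a" where "\<theta> u v = fst (mult (0, u) (0, v))"
definition \<mu> :: "'a \<Rightarrow> 'b \<Rightarrow> 'b" where "\<mu> x v = snd (mult (x, 0) (0, v))"
definition \<nu> :: "'b \<Rightarrow> 'a \<Rightarrow> 'a" where "\<nu> u y = fst (mult (0, u) (y, 0))"

definition brk1 :: "'a \<Rightarrow> 'a \<Rightarrow> 'a" where "brk1 x y = fst (brk (x, 0) (y, 0))"
definition brk2 :: "'b \<Rightarrow> 'b \<Rightarrow> 'b" where "brk2 u v = snd (brk (0, u) (0, v))"
definition H :: "'a \<Rightarrow> 'a \<Rightarrow> 'b" where "H x y = snd (brk (x, 0) (y, 0))"
definition \<Theta> :: "'b \<Rightarrow> 'b \<Rightarrow> 'a" where "\<Theta> u v = fst (brk (0, u) (0, v))"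
definition \<rho> :: "'a \<Rightarrow> 'b \<Rightarrow> 'b" where "\<rho> x v = snd (brk (x, 0) (0, v))"
definition \<psi> :: "'b \<Rightarrow> 'a \<Rightarrow> 'a" where "\<psi> u y = fst (brk (0, u) (y, 0))"

lemma mult_components:
  "mult (x, u) (y, v) =
     (dot1 x y + \<nu> u y + \<nu> v x + \<theta> u v, dot2 u v + \<mu> x v + \<mu> y u + h x y)"
proof -
  have "mult (x, u) (y, v) = mult ((x, 0) + (0, u)) ((y, 0) + (0, v))"
    by simp
  also have "\<dots> = mult (x, 0) (y, 0) + mult (0, u) (y, 0) + (mult (0, v) (x, 0) + mult (0, u) (0, v))"
    unfolding module_hom.add[OF mult_linear_right] module_hom.add[OF mult_linear_left]
    using mult_commute[of "(0, v)" "(x, 0)"] by simp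
  finally show ?thesis
    using mult_commute[of "(0, u)" "(y, 0)"] mult_commute[of "(0, v)" "(x, 0)"]
    by (simp add: prod_eq_iff dot1_def dot2_def h_def \<theta>_def \<mu>_def \<nu>_def algebra_simps)
qed

lemma brk_components:
  "brk (x, u) (y, v) =
     (brk1 x y + \<psi> u y - \<psi> v x + \<Theta> u v, brk2 u v + \<rho> x v - \<rho> y u + H x y)"
proof -
  have "brk (x, u) (y, v) = brk ((x, 0) + (0, u)) ((y, 0) + (0, v))"
    by simp
  also have "\<dots> = brk (x, 0) (y, 0) + brk (0, u) (y, 0) + (brk (x, 0) (0, v) + brk (0, u) (0, v))"
    unfolding module_hom.add[OF brk_linear_right] module_hom.add[OF brk_linear_left] ..
  finally show ?thesis
    using brk_antisym[of "(0, u)" "(y, 0)"] brk_antisym[of "(0, v)" "(x, 0)"]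
    by (simp add: prod_eq_iff brk1_def brk2_def H_def \<Theta>_def \<rho>_def \<psi>_def algebra_simps)
qed

subsection \<open>Deformation maps and their homomorphisms\<close>

definition deformation_map :: "('b \<Rightarrow> 'a) \<Rightarrow> bool" where
  "deformation_map r \<longleftrightarrow> module_hom s2 s1 r \<and> poisson_subalgebra {(r u, u) | u. True}"

definition deformation_map_hom ::
    "('b \<Rightarrow> 'a) \<Rightarrow> ('b \<Rightarrow> 'a) \<Rightarrow> ('a \<Rightarrow> 'a) \<Rightarrow> ('b \<Rightarrow> 'b) \<Rightarrow> bool" where
  "deformation_map_hom r r' \<phi>1 \<phi>2 \<longleftrightarrow>
     deformation_map r \<and> deformation_map r' \<and>
     module_hom s1 s1 \<phi>1 \<and> module_hom s2 s2 \<phi>2 \<and>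
     poisson_endomorphism (map_prod \<phi>1 \<phi>2) \<and>
     \<phi>1 \<circ> r = r' \<circ> \<phi>2"

subsection \<open>Cohomology in degrees 0 and 1\<close>

definition dot_r :: "('b \<Rightarrow> 'a) \<Rightarrow> 'b \<Rightarrow> 'b \<Rightarrow> 'b" where
  "dot_r r u v = dot2 u v + \<mu> (r u) v + \<mu> (r v) u + h (r u) (r v)"

definition brk_r :: "('b \<Rightarrow> 'a) \<Rightarrow> 'b \<Rightarrow> 'b \<Rightarrow> 'b" where
  "brk_r r u v = brk2 u v + \<rho> (r u) v - \<rho> (r v) u + H (r u) (r v)"

definition \<nu>_r :: "('b \<Rightarrow> 'a) \<Rightarrow> 'b \<Rightarrow> 'a \<Rightarrow> 'a" where
  "\<nu>_r r u x = \<nu> u x + dot1 (r u) x - r (\<mu> x u + h (r u) x)"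

definition \<psi>_r :: "('b \<Rightarrow> 'a) \<Rightarrow> 'b \<Rightarrow> 'a \<Rightarrow> 'a" where
  "\<psi>_r r u x = \<psi> u x + brk1 (r u) x - r (- \<rho> x u + H (r u) x)"

definition \<delta>_FGV :: "('b \<Rightarrow> 'a) \<Rightarrow> 'a \<Rightarrow> ('b \<Rightarrow> 'a)" where
  "\<delta>_FGV r x = (\<lambda>u. \<psi>_r r u x)"

definition Z1 :: "('b \<Rightarrow> 'a) \<Rightarrow> ('b \<Rightarrow> 'a) set" where
  "Z1 r = {f. module_hom s2 s1 f \<and>
     (\<forall>u v. f (dot_r r u v) = \<nu>_r r u (f v) + \<nu>_r r v (f u)) \<and>
     (\<forall>u v. f (brk_r r u v) = \<psi>_r r u (f v) - \<psi>_r r v (f u))}"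

subsection \<open>Nijenhuis elements\<close>

definition Nij :: "('b \<Rightarrow> 'a) \<Rightarrow> 'a set" where
  "Nij r = {x0.
     (\<forall>t. poisson_endomorphism
        (\<lambda>(x, u). (x + s1 t (brk1 x0 x), u + s2 t (\<rho> x0 u + H x0 (r u))))) \<and>
     (\<forall>u. brk1 (brk1 (r u) x0 - r (- \<rho> x0 u + H (r u) x0)) x0 = 0)}"

end

section \<open>Extension to formal power series\<close>

text \<open>For a bilinear \<open>f\<close>, this is its \<open>k[[t]]\<close>-bilinear (Cauchy product) extension. It covers the scalar
  action of \<open>k[[t]]\<close> on \<open>V[[t]]\<close> and, with \<open>f = (\<lambda>g x. g x)\<close>, the action of \<open>Hom(V,W)[[t]]\<close>.\<close>

definition fps_bilin :: "('a \<Rightarrow> 'b \<Rightarrow> 'c::comm_monoid_add) \<Rightarrow> 'a fps \<Rightarrow> 'b fps \<Rightarrow> 'c fps" where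
  "fps_bilin f X Y = Abs_fps (\<lambda>n. \<Sum>i=0..n. f (X $ i) (Y $ (n - i)))"

definition fps_extend :: "('b \<Rightarrow> 'a::comm_monoid_add) fps \<Rightarrow> 'b fps \<Rightarrow> 'a fps" where
  "fps_extend = fps_bilin (\<lambda>g x. g x)"

text \<open>The identification \<open>(P\<^sub>1 \<oplus> P\<^sub>2)[[t]] \<cong> P\<^sub>1[[t]] \<oplus> P\<^sub>2[[t]]\<close>.\<close>

definition fps_pair :: "'a fps \<times> 'b fps \<Rightarrow> ('a \<times> 'b) fps" where
  "fps_pair p = Abs_fps (\<lambda>n. (fst p $ n, snd p $ n))"

definition fps_unpair :: "('a \<times> 'b) fps \<Rightarrow> 'a fps \<times> 'b fps" where
  "fps_unpair Z = (Abs_fps (\<lambda>n. fst (Z $ n)), Abs_fps (\<lambda>n. snd (Z $ n)))"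

definition fps_prod_bilin ::
    "('a \<times> 'b \<Rightarrow> 'a \<times> 'b \<Rightarrow> ('a::comm_monoid_add) \<times> ('b::comm_monoid_add)) \<Rightarrow>
     'a fps \<times> 'b fps \<Rightarrow> 'a fps \<times> 'b fps \<Rightarrow> 'a fps \<times> 'b fps" where
  "fps_prod_bilin m p q = fps_unpair (fps_bilin m (fps_pair p) (fps_pair q))"

section \<open>Formal deformations and rigidity\<close>

text \<open>Below, \<open>proto_twilled_poisson.deformation_map\<close> and \<open>proto_twilled_poisson.deformation_map_hom\<close>
  are used for the proto-twilled Poisson algebra \<open>P[[t]]\<close> over \<open>k[[t]]\<close>; that it is one is
  \<open>proto_twilled_poisson_fps\<close> at the end of this theory.\<close>

definition undeformed :: "('b \<Rightarrow> 'a::zero) \<Rightarrow> ('b \<Rightarrow> 'a) fps" where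
  "undeformed r = Abs_fps (\<lambda>n. if n = 0 then r else (\<lambda>_. 0))"

context proto_twilled_poisson
begin

definition formal_deformation :: "('b \<Rightarrow> 'a) \<Rightarrow> ('b \<Rightarrow> 'a) fps \<Rightarrow> bool" where
  "formal_deformation r rt \<longleftrightarrow>
     (\<forall>i. module_hom s2 s1 (rt $ i)) \<and> rt $ 0 = r \<and>
     proto_twilled_poisson.deformation_map (fps_bilin s1) (fps_bilin s2)
       (fps_prod_bilin mult) (fps_prod_bilin brk) (fps_extend rt)"

definition equivalent_deformations ::
    "('b \<Rightarrow> 'a) \<Rightarrow> ('b \<Rightarrow> 'a) fps \<Rightarrow> ('b \<Rightarrow> 'a) fps \<Rightarrow> bool" where
  "equivalent_deformations r rt rt' \<longleftrightarrow>
     (\<exists>x0 \<phi>1 \<phi>2.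
        \<phi>1 $ 0 = id \<and> \<phi>1 $ 1 = (\<lambda>x. brk1 x0 x) \<and> (\<forall>i\<ge>2. module_hom s1 s1 (\<phi>1 $ i)) \<and>
        \<phi>2 $ 0 = id \<and> \<phi>2 $ 1 = (\<lambda>u. \<rho> x0 u + H x0 (r u)) \<and> (\<forall>i\<ge>2. module_hom s2 s2 (\<phi>2 $ i)) \<and>
        proto_twilled_poisson.deformation_map_hom (fps_bilin s1) (fps_bilin s2)
          (fps_prod_bilin mult) (fps_prod_bilin brk)
          (fps_extend rt) (fps_extend rt') (fps_extend \<phi>1) (fps_extend \<phi>2))"

definition rigid :: "('b \<Rightarrow> 'a) \<Rightarrow> bool" where
  "rigid r \<longleftrightarrow>
     (\<forall>rt. formal_deformation r rt \<longrightarrow> equivalent_deformations r rt (undeformed r))"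

end

section \<open>The power series extension is a proto-twilled Poisson algebra\<close>

lemma fps_bilin_nth: "fps_bilin f X Y $ n = (\<Sum>i=0..n. f (X $ i) (Y $ (n - i)))"
  by (simp add: fps_bilin_def)

definition tri :: "nat \<Rightarrow> (nat \<times> nat \<times> nat) set" where
  "tri n = {(i, j, k). i + j + k = n}"

lemma fps_bilin_right_nth:
  assumes "\<And>x. additive (f x)"
  shows "fps_bilin f X (fps_bilin g Y Z) $ n = (\<Sum>(i,j,k)\<in>tri n. f (X $ i) (g (Y $ j) (Z $ k)))"
proof -
  have "fps_bilin f X (fps_bilin g Y Z) $ n =
      (\<Sum>i=0..n. \<Sum>j=0..n-i. f (X $ i) (g (Y $ j) (Z $ (n - i - j))))"
    by (simp add: fps_bilin_nth additive.sum[OF assms])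
  also have "\<dots> = (\<Sum>(i,j)\<in>Sigma {0..n} (\<lambda>i. {0..n-i}). f (X $ i) (g (Y $ j) (Z $ (n - i - j))))"
    by (rule sum.Sigma) auto
  also have "\<dots> = (\<Sum>(i,j,k)\<in>tri n. f (X $ i) (g (Y $ j) (Z $ k)))"
    by (rule sum.reindex_bij_witness[where i = "\<lambda>(i,j,k). (i,j)" and j = "\<lambda>(i,j). (i,j,n-i-j)"])
      (auto simp: tri_def)
  finally show ?thesis .
qed

lemma fps_bilin_left_nth:
  assumes "\<And>z. additive (\<lambda>x. f x z)"
  shows "fps_bilin f (fps_bilin g X Y) Z $ n = (\<Sum>(i,j,k)\<in>tri n. f (g (X $ i) (Y $ j)) (Z $ k))"
proof -
  have "fps_bilin f (fps_bilin g X Y) Z $ n =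
      (\<Sum>i=0..n. \<Sum>j=0..i. f (g (X $ j) (Y $ (i - j))) (Z $ (n - i)))"
    by (simp add: fps_bilin_nth additive.sum[OF assms])
  also have "\<dots> = (\<Sum>(i,j)\<in>Sigma {0..n} (\<lambda>i. {0..i}). f (g (X $ j) (Y $ (i - j))) (Z $ (n - i)))"
    by (rule sum.Sigma) auto
  also have "\<dots> = (\<Sum>(i,j,k)\<in>tri n. f (g (X $ i) (Y $ j)) (Z $ k))"
    by (rule sum.reindex_bij_witness[where i = "\<lambda>(i,j,k). (i+j,i)" and j = "\<lambda>(i,j). (j,i-j,n-i)"])
      (auto simp: tri_def)
  finally show ?thesis .
qed

lemma tri_rotate: "(\<Sum>(i,j,k)\<in>tri n. F i j k) = (\<Sum>(i,j,k)\<in>tri n. F j k i)"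
  by (rule sum.reindex_bij_witness[where i = "\<lambda>(i,j,k). (j,k,i)" and j = "\<lambda>(i,j,k). (k,i,j)"])
    (auto simp: tri_def)

lemma tri_swap: "(\<Sum>(i,j,k)\<in>tri n. F i j k) = (\<Sum>(i,j,k)\<in>tri n. F j i k)"
  by (rule sum.reindex_bij_witness[where i = "\<lambda>(i,j,k). (j,i,k)" and j = "\<lambda>(i,j,k). (j,i,k)"])
    (auto simp: tri_def)

lemma fps_bilin_commute:
  assumes "\<And>x y. f x y = g y x"
  shows "fps_bilin f X Y = fps_bilin g Y X"
proof (rule fps_ext)
  fix n
  show "fps_bilin f X Y $ n = fps_bilin g Y X $ n"
    unfolding fps_bilin_nth assms
    by (rule sum.reindex_bij_witness[where i = "\<lambda>i. n - i" and j = "\<lambda>i. n - i"]) auto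
qed

lemma fps_bilin_self:
  fixes f :: "'a::ab_group_add \<Rightarrow> 'a \<Rightarrow> 'b::ab_group_add"
  assumes "\<And>x. f x x = 0" "\<And>x y. f x y = - f y x"
  shows "fps_bilin f X X = 0"
proof (rule fps_ext)
  fix n
  define F where "F i = f (X $ i) (X $ (n - i))" for i
  define A where "A = {i\<in>{0..n}. 2 * i < n}"
  define B where "B = {i\<in>{0..n}. n < 2 * i}"
  define C where "C = {i\<in>{0..n}. 2 * i = n}"
  have split: "{0..n} = A \<union> (B \<union> C)" by (auto simp: A_def B_def C_def)
  have "sum F {0..n} = sum F A + (sum F B + sum F C)"
    unfolding split
    by (subst sum.union_disjoint; (subst sum.union_disjoint)?) (auto simp: A_def B_def C_def)
  moreover have "sum F C = 0"
  proof (rule sum.neutral, rule ballI)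
    fix i assume "i \<in> C"
    then have "n - i = i" by (auto simp: C_def)
    then show "F i = 0" by (simp add: F_def assms(1))
  qed
  moreover have "sum F B = sum (\<lambda>i. - F i) A"
  proof (rule sum.reindex_bij_witness[where i = "\<lambda>i. n - i" and j = "\<lambda>i. n - i"])
    fix i assume "i \<in> B"
    then have "n - (n - i) = i" by (auto simp: B_def)
    then show "- F (n - i) = F i"
      using assms(2)[of "X $ i" "X $ (n - i)"] by (simp add: F_def)
  qed (auto simp: A_def B_def)
  ultimately have "sum F {0..n} = 0" by (simp add: sum_negf)
  then show "fps_bilin f X X $ n = 0 $ n" by (simp add: fps_bilin_nth F_def)
qed

lemma fps_bilin_add_right:
  assumes "\<And>x y y'. f x (y + y') = f x y + f x y'"
  shows "fps_bilin f X (Y + Y') = fps_bilin f X Y + fps_bilin f X Y'"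
  by (rule fps_ext) (simp add: fps_bilin_nth assms sum.distrib)

lemma fps_bilin_add_left:
  assumes "\<And>x x' y. f (x + x') y = f x y + f x' y"
  shows "fps_bilin f (X + X') Y = fps_bilin f X Y + fps_bilin f X' Y"
  by (rule fps_ext) (simp add: fps_bilin_nth assms sum.distrib)

context module
begin

lemma additive_scale: "additive (scale c)" "additive (\<lambda>c. scale c x)"
  by (unfold_locales) (simp_all add: scale_right_distrib scale_left_distrib)

lemma module_fps: "module (fps_bilin scale)"
proof
  fix a b :: "'a fps" and x y :: "'b fps"
  show "fps_bilin scale a (x + y) = fps_bilin scale a x + fps_bilin scale a y"
    by (rule fps_bilin_add_right) (rule scale_right_distrib)
  show "fps_bilin scale (a + b) x = fps_bilin scale a x + fps_bilin scale b x"
    by (rule fps_bilin_add_left) (rule scale_left_distrib)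
  have times: "a * b = fps_bilin (*) a b"
    by (rule fps_ext) (simp add: fps_bilin_nth fps_mult_nth)
  show "fps_bilin scale a (fps_bilin scale b x) = fps_bilin scale (a * b) x"
    unfolding times
    by (rule fps_ext)
      (simp add: fps_bilin_right_nth[OF additive_scale(1)] fps_bilin_left_nth[OF additive_scale(2)])
  show "fps_bilin scale 1 x = x"
  proof (rule fps_ext)
    fix n
    have "fps_bilin scale 1 x $ n = (\<Sum>i=0..n. if i = 0 then x $ n else 0)"
      unfolding fps_bilin_nth by (rule sum.cong) auto
    then show "fps_bilin scale 1 x $ n = x $ n" by simp
  qed
qed

end

lemma poisson_algebra_fps:
  fixes scale :: "'k::comm_ring_1 \<Rightarrow> 'p::ab_group_add \<Rightarrow> 'p" and mult brk :: "'p \<Rightarrow> 'p \<Rightarrow> 'p"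
  assumes "poisson_algebra scale mult brk"
  shows "poisson_algebra (fps_bilin scale) (fps_bilin mult) (fps_bilin brk)"
proof -
  interpret poisson_algebra scale mult brk by fact
  have hom: "module_hom (fps_bilin scale) (fps_bilin scale) (fps_bilin f X)"
    if lin: "\<And>x. module_hom scale scale (f x)" "\<And>y. module_hom scale scale (\<lambda>x. f x y)" for f X
  proof -
    have add: "additive (f x)" for x
      by unfold_locales (rule module_hom.add[OF lin(1)])
    show ?thesis
      unfolding module_hom_def module_hom_axioms_def
    proof (intro conjI allI module_fps)
      show "fps_bilin f X (Y + Y') = fps_bilin f X Y + fps_bilin f X Y'" for Y Y'
        by (rule fps_bilin_add_right) (rule additive.add[OF add])
      show "fps_bilin f X (fps_bilin scale c Y) = fps_bilin scale c (fps_bilin f X Y)" for c Y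
        by (rule fps_ext, unfold fps_bilin_right_nth[OF add] fps_bilin_right_nth[OF additive_scale(1)],
            subst tri_swap)
          (simp add: module_hom.scale[OF lin(1)])
    qed
  qed
  have m: "additive (mult x)" "additive (\<lambda>x. mult x y)" for x y
    by (unfold_locales)
      (simp_all add: module_hom.add[OF mult_linear_right] module_hom.add[OF mult_linear_left])
  have b: "additive (brk x)" "additive (\<lambda>x. brk x y)" for x y
    by (unfold_locales)
      (simp_all add: module_hom.add[OF brk_linear_right] module_hom.add[OF brk_linear_left])
  have left: "fps_bilin f X Y = fps_bilin (\<lambda>y x. f x y) Y X" for f :: "'p \<Rightarrow> 'p \<Rightarrow> 'p" and X Y
    by (rule fps_bilin_commute) simp
  interpret F: module "fps_bilin scale"
    by (rule module_fps)
  show ?thesis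
  proof unfold_locales
    fix X Y Z :: "'p fps"
    show "fps_bilin mult X Y = fps_bilin mult Y X"
      by (rule fps_bilin_commute) (rule mult_commute)
    show "fps_bilin mult (fps_bilin mult X Y) Z = fps_bilin mult X (fps_bilin mult Y Z)"
      by (rule fps_ext)
        (simp add: fps_bilin_right_nth[OF m(1)] fps_bilin_left_nth[OF m(2)] mult_assoc)
    show "fps_bilin brk X X = 0"
      by (rule fps_bilin_self) (rule brk_self brk_antisym)+
    show "fps_bilin brk X (fps_bilin brk Y Z) + fps_bilin brk Y (fps_bilin brk Z X)
        + fps_bilin brk Z (fps_bilin brk X Y) = 0"
    proof (rule fps_ext)
      fix n
      have 1: "(\<Sum>(i,j,k)\<in>tri n. brk (Y $ i) (brk (Z $ j) (X $ k)))
          = (\<Sum>(i,j,k)\<in>tri n. brk (Y $ j) (brk (Z $ k) (X $ i)))"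
        by (rule tri_rotate)
      have 2: "(\<Sum>(i,j,k)\<in>tri n. brk (Z $ i) (brk (X $ j) (Y $ k)))
          = (\<Sum>(i,j,k)\<in>tri n. brk (Z $ k) (brk (X $ i) (Y $ j)))"
        by (subst tri_rotate, rule tri_rotate)
      show "(fps_bilin brk X (fps_bilin brk Y Z) + fps_bilin brk Y (fps_bilin brk Z X)
          + fps_bilin brk Z (fps_bilin brk X Y)) $ n = 0 $ n"
        unfolding fps_add_nth fps_bilin_right_nth[OF b(1)] 1 2
        by (simp add: sum.distrib[symmetric] case_prod_unfold jacobi)
    qed
    show "fps_bilin brk X (fps_bilin mult Y Z)
        = fps_bilin mult (fps_bilin brk X Y) Z + fps_bilin mult Y (fps_bilin brk X Z)"
    proof (rule fps_ext)
      fix n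
      have 1: "(\<Sum>(i,j,k)\<in>tri n. mult (Y $ i) (brk (X $ j) (Z $ k)))
          = (\<Sum>(i,j,k)\<in>tri n. mult (Y $ j) (brk (X $ i) (Z $ k)))"
        by (rule tri_swap)
      show "fps_bilin brk X (fps_bilin mult Y Z) $ n
          = (fps_bilin mult (fps_bilin brk X Y) Z + fps_bilin mult Y (fps_bilin brk X Z)) $ n"
        unfolding fps_add_nth fps_bilin_right_nth[OF b(1)] fps_bilin_right_nth[OF m(1)]
          fps_bilin_left_nth[OF m(2)] 1
        by (simp add: sum.distrib[symmetric] case_prod_unfold leibniz)
    qed
    show "fps_bilin mult X (Y + Z) = fps_bilin mult X Y + fps_bilin mult X Z"
      "fps_bilin brk X (Y + Z) = fps_bilin brk X Y + fps_bilin brk X Z"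
      using module_hom.add[OF hom] mult_linear_left mult_linear_right
        brk_linear_left brk_linear_right by blast+
    show "fps_bilin mult (X + Y) Z = fps_bilin mult X Z + fps_bilin mult Y Z"
      "fps_bilin brk (X + Y) Z = fps_bilin brk X Z + fps_bilin brk Y Z"
      by (subst (1 2 3) left, rule module_hom.add[OF hom];
          rule mult_linear_left mult_linear_right brk_linear_left brk_linear_right)+
    fix c
    show "fps_bilin mult X (fps_bilin scale c Y) = fps_bilin scale c (fps_bilin mult X Y)"
      "fps_bilin brk X (fps_bilin scale c Y) = fps_bilin scale c (fps_bilin brk X Y)"
      using module_hom.scale[OF hom] mult_linear_left mult_linear_right
        brk_linear_left brk_linear_right by blast+
    show "fps_bilin mult (fps_bilin scale c X) Y = fps_bilin scale c (fps_bilin mult X Y)"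
      unfolding left[of mult] by (rule module_hom.scale[OF hom]) (rule mult_linear_left mult_linear_right)+
    show "fps_bilin brk (fps_bilin scale c X) Y = fps_bilin scale c (fps_bilin brk X Y)"
      unfolding left[of brk] by (rule module_hom.scale[OF hom]) (rule brk_linear_left brk_linear_right)+
  qed
qed

lemma fps_pair_inverse [simp]: "fps_pair (fps_unpair Z) = Z"
  by (rule fps_ext) (simp add: fps_pair_def fps_unpair_def)

lemma fps_unpair_inverse [simp]: "fps_unpair (fps_pair p) = p"
  by (simp add: fps_pair_def fps_unpair_def prod_eq_iff fps_eq_iff)

lemma fps_pair_add: "fps_pair (p + q) = fps_pair p + fps_pair q"
  by (rule fps_ext) (simp add: fps_pair_def)

lemma fps_pair_0: "fps_pair 0 = 0"
  by (rule fps_ext) (simp add: fps_pair_def zero_prod_def)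

lemma fps_pair_prod_bilin:
  "fps_pair (fps_prod_bilin m p q) = fps_bilin m (fps_pair p) (fps_pair q)"
  by (simp add: fps_prod_bilin_def)

lemma fps_pair_scale:
  fixes s1 :: "'k \<Rightarrow> 'a \<Rightarrow> 'a::comm_monoid_add" and s2 :: "'k \<Rightarrow> 'b \<Rightarrow> 'b::comm_monoid_add"
  shows
  "fps_pair (prod_scale (fps_bilin s1) (fps_bilin s2) c p) = fps_bilin (prod_scale s1 s2) c (fps_pair p)"
proof (rule fps_ext)
  fix n
  have "(\<Sum>i\<in>I. (f i, g i)) = (sum f I, sum g I)" for f :: "nat \<Rightarrow> 'a" and g :: "nat \<Rightarrow> 'b" and I
    by (induction I rule: infinite_finite_induct) (simp_all add: zero_prod_def)
  then show "fps_pair (prod_scale (fps_bilin s1) (fps_bilin s2) c p) $ n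
      = fps_bilin (prod_scale s1 s2) c (fps_pair p) $ n"
    by (simp add: fps_pair_def prod_scale_def fps_bilin_nth)
qed

lemma fps_pair_inj: "p = q \<longleftrightarrow> fps_pair p = fps_pair q"
  by (metis fps_unpair_inverse)

theorem proto_twilled_poisson_fps:
  fixes mult brk :: "'a::ab_group_add \<times> 'b::ab_group_add \<Rightarrow> 'a \<times> 'b \<Rightarrow> 'a \<times> 'b"
  assumes "proto_twilled_poisson s1 s2 mult brk"
  shows "proto_twilled_poisson (fps_bilin s1) (fps_bilin s2) (fps_prod_bilin mult) (fps_prod_bilin brk)"
proof -
  interpret proto_twilled_poisson s1 s2 mult brk by fact
  interpret F: poisson_algebra "fps_bilin (prod_scale s1 s2)" "fps_bilin mult" "fps_bilin brk"
    by (rule poisson_algebra_fps) (rule poisson_algebra_axioms)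
  note transfer = fps_pair_inj fps_pair_add fps_pair_0 fps_pair_prod_bilin fps_pair_scale
  note lin = module_hom.add[OF F.mult_linear_right] module_hom.add[OF F.mult_linear_left]
    module_hom.add[OF F.brk_linear_right] module_hom.add[OF F.brk_linear_left]
    module_hom.scale[OF F.mult_linear_right] module_hom.scale[OF F.mult_linear_left]
    module_hom.scale[OF F.brk_linear_right] module_hom.scale[OF F.brk_linear_left]
  have mod: "module (prod_scale (fps_bilin s1) (fps_bilin s2))"
    by unfold_locales (unfold transfer, simp_all add: F.scale_right_distrib F.scale_left_distrib)
  have "poisson_algebra (prod_scale (fps_bilin s1) (fps_bilin s2))
      (fps_prod_bilin mult) (fps_prod_bilin brk)"
    unfolding poisson_algebra_def poisson_algebra_axioms_def module_hom_def module_hom_axioms_def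
    by (intro conjI allI mod; unfold transfer; (rule lin F.mult_commute F.mult_assoc F.brk_self F.jacobi F.leibniz))
  then show ?thesis
    by (intro proto_twilled_poisson.intro P1.module_fps P2.module_fps)
qed

end

theory Submission
  imports Defs
begin

text \<open>If \<open>\<phi>\<^sub>1, \<phi>\<^sub>2\<close> form a homomorphism with \<open>\<phi>\<^sub>1 r\<^sub>t = r \<phi>\<^sub>2\<close> modulo \<open>t\<^sup>m\<close>, the coefficient of \<open>t\<^sup>m\<close> in
  \<open>\<phi>\<^sub>1 r\<^sub>t - r \<phi>\<^sub>2\<close> is a 1-cocycle, hence equal to \<open>\<delta>(x)\<close> for a Nijenhuis element \<open>x\<close>. The map \<open>D\<close> attached to
  \<open>x\<close> is a derivation of both operations whose image has zero products and brackets, because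
  \<open>id + c D\<close> is a homomorphism for \<open>c = 1\<close> and \<open>c = -1\<close>. So \<open>id + t\<^sup>m D\<close> is a homomorphism as well, and
  composing with it removes the coefficient of \<open>t\<^sup>m\<close>, since \<open>\<psi> = 0\<close> turns \<open>D\<^sub>1 r - r D\<^sub>2\<close> into \<open>- \<delta>(x)\<close>.
  The infinite composition converges \<open>t\<close>-adically, and its linear term comes from the first step.\<close>

section \<open>Power series of maps\<close>

lemma fps_extend_nth: "fps_extend g X $ n = (\<Sum>i=0..n. (g $ i) (X $ (n - i)))"
  by (simp add: fps_extend_def fps_bilin_nth)

lemma fps_extend_undeformed_nth: "fps_extend (undeformed g) X $ n = g (X $ n)"
proof -
  have "fps_extend (undeformed g) X $ n = (\<Sum>i=0..n. if i = 0 then g (X $ n) else 0)"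
    unfolding fps_extend_nth undeformed_def by (rule sum.cong) auto
  then show ?thesis by simp
qed

text \<open>Evaluation on constant series isolates single coefficients of \<open>g\<close>, so
  identities over k[[t]] can be read back degree by degree.\<close>

lemma fps_extend_const_nth:
  assumes "\<And>i. (g $ i) 0 = 0"
  shows "fps_extend g (fps_const u) $ n = (g $ n) u"
proof -
  have "fps_extend g (fps_const u) $ n = (\<Sum>i=0..n. if i = n then (g $ n) u else 0)"
    unfolding fps_extend_nth by (rule sum.cong) (auto simp: assms)
  then show ?thesis by simp
qed

lemma module_hom_fps_extend:
  assumes "\<And>i. module_hom s s' (g $ i)"
  shows "module_hom (fps_bilin s) (fps_bilin s') (fps_extend g)"
proof -
  interpret h: module_hom s s' "g $ i" for i by (rule assms)
  have add: "additive (g $ i)" for i by unfold_locales (rule h.add)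
  interpret M: module "fps_bilin s" by (rule h.m1.module_fps)
  interpret N: module "fps_bilin s'" by (rule h.m2.module_fps)
  show ?thesis
  proof unfold_locales
    show "fps_extend g (X + Y) = fps_extend g X + fps_extend g Y" for X Y
      by (rule fps_ext) (simp add: fps_extend_nth h.add sum.distrib)
    show "fps_extend g (fps_bilin s c X) = fps_bilin s' c (fps_extend g X)" for c X
    proof (rule fps_ext)
      fix n
      \<comment> \<open>\<open>Abs_fps id\<close> has the number i as its i-th coefficient. This
        makes the action of \<open>g\<close> a Cauchy product for the pairing of an index i with x
        given by \<open>(g $ i) x\<close>, and the reindexing over \<open>tri n\<close>
        applies.\<close>
      have "fps_extend g (fps_bilin s c X) $ n
          = fps_bilin (\<lambda>i. g $ i) (Abs_fps id) (fps_bilin s c X) $ n"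
        by (simp add: fps_extend_nth fps_bilin_nth)
      also have "\<dots> = (\<Sum>(i,j,k)\<in>tri n. (g $ i) (s (c $ j) (X $ k)))"
        by (simp add: fps_bilin_right_nth[OF add])
      also have "\<dots> = (\<Sum>(i,j,k)\<in>tri n. s' (c $ i) ((g $ j) (X $ k)))"
        by (subst tri_swap) (simp add: h.scale)
      also have "\<dots> = fps_bilin s' c (fps_bilin (\<lambda>i. g $ i) (Abs_fps id) X) $ n"
        by (simp add: fps_bilin_right_nth[OF h.m2.additive_scale(1)])
      also have "fps_bilin (\<lambda>i. g $ i) (Abs_fps id) X = fps_extend g X"
        by (rule fps_ext) (simp add: fps_extend_nth fps_bilin_nth)
      finally show "fps_extend g (fps_bilin s c X) $ n = fps_bilin s' c (fps_extend g X) $ n" .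
    qed
  qed
qed

text \<open>The product of Hom[[t]], i.e. the Cauchy product with composition of maps as
  multiplication; it is not substitution of series.\<close>

definition fps_comp :: "('b \<Rightarrow> 'c::comm_monoid_add) fps \<Rightarrow> ('a \<Rightarrow> 'b) fps \<Rightarrow> ('a \<Rightarrow> 'c) fps" where
  "fps_comp f g = Abs_fps (\<lambda>n x. \<Sum>i=0..n. (f $ i) ((g $ (n - i)) x))"

lemma fps_comp_nth: "(fps_comp f g $ n) x = (\<Sum>i=0..n. (f $ i) ((g $ (n - i)) x))"
  by (simp add: fps_comp_def)

lemma fps_comp_nth_0: "fps_comp f g $ 0 = f $ 0 \<circ> g $ 0"
  by (simp add: fun_eq_iff fps_comp_nth)

text \<open>Additivity moves each \<open>f $ i\<close> through the inner Cauchy sum; the rest is a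
  change of summation order over a triangle.\<close>

lemma fps_extend_comp:
  assumes add: "\<And>i. additive (f $ i)"
  shows "fps_extend (fps_comp f g) X = fps_extend f (fps_extend g X)"
proof (rule fps_ext)
  fix n
  have "fps_extend (fps_comp f g) X $ n =
      (\<Sum>i=0..n. \<Sum>j=0..i. (f $ j) ((g $ (i - j)) (X $ (n - i))))"
    by (simp add: fps_extend_nth fps_comp_nth)
  also have "\<dots> = (\<Sum>(i,j)\<in>Sigma {0..n} (\<lambda>i. {0..i}). (f $ j) ((g $ (i - j)) (X $ (n - i))))"
    by (rule sum.Sigma) auto
  also have "\<dots> = (\<Sum>(i,j)\<in>Sigma {0..n} (\<lambda>i. {0..n-i}). (f $ i) ((g $ j) (X $ (n - i - j))))"
    by (rule sum.reindex_bij_witness[where i = "\<lambda>(i,j). (i+j,i)" and j = "\<lambda>(i,j). (j,i-j)"])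
      auto
  also have "\<dots> = (\<Sum>i=0..n. \<Sum>j=0..n-i. (f $ i) ((g $ j) (X $ (n - i - j))))"
    by (rule sum.Sigma[symmetric]) auto
  also have "\<dots> = fps_extend f (fps_extend g X) $ n"
    by (simp add: fps_extend_nth additive.sum[OF add])
  finally show "fps_extend (fps_comp f g) X $ n = fps_extend f (fps_extend g X) $ n" .
qed

text \<open>Freezing the argument x turns composition into an action on vector series, so
  associativity reduces to \<open>fps_extend_comp\<close>.\<close>

lemma fps_comp_eq_extend: "(fps_comp f g $ n) x = fps_extend f (Abs_fps (\<lambda>k. (g $ k) x)) $ n"
  by (simp add: fps_comp_nth fps_extend_nth)

lemma fps_comp_assoc:
  assumes "\<And>i. additive (f $ i)"
  shows "fps_comp (fps_comp f g) k = fps_comp f (fps_comp g k)"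
proof (intro fps_ext ext)
  fix n x
  have "fps_extend g (Abs_fps (\<lambda>i. (k $ i) x)) = Abs_fps (\<lambda>i. (fps_comp g k $ i) x)"
    by (rule fps_ext) (simp add: fps_comp_eq_extend)
  then show "(fps_comp (fps_comp f g) k $ n) x = (fps_comp f (fps_comp g k) $ n) x"
    by (simp add: fps_comp_eq_extend[of "fps_comp f g"] fps_comp_eq_extend[of f]
        fps_extend_comp[OF assms])
qed

lemma module_hom_sum_comp:
  assumes f: "\<And>i. module_hom s' s'' (f i)" and g: "\<And>i. module_hom s s' (g i)"
  shows "module_hom s s'' (\<lambda>x. \<Sum>i\<in>I. f i (g i x))"
proof -
  interpret f: module_hom s' s'' "f i" for i by (rule f)
  interpret g: module_hom s s' "g i" for i by (rule g)
  show ?thesis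
    by unfold_locales
      (simp_all add: f.add g.add f.scale g.scale sum.distrib f.m2.scale_sum_right)
qed

lemma module_hom_fps_comp:
  assumes "\<And>i. module_hom s' s'' (f $ i)" "\<And>i. module_hom s s' (g $ i)"
  shows "module_hom s s'' (fps_comp f g $ n)"
proof -
  have "fps_comp f g $ n = (\<lambda>x. \<Sum>i=0..n. (f $ i) ((g $ (n - i)) x))"
    by (rule ext) (rule fps_comp_nth)
  moreover have "module_hom s s'' \<dots>"
    by (rule module_hom_sum_comp[where f = "\<lambda>i. f $ i" and g = "\<lambda>i. g $ (n - i)"]) (rule assms)+
  ultimately show ?thesis by simp
qed

section \<open>Direct sums of operator series and the perturbations id + t^m D\<close>

definition fps_map_prod :: "('a \<Rightarrow> 'c) fps \<Rightarrow> ('b \<Rightarrow> 'd) fps \<Rightarrow> ('a \<times> 'b \<Rightarrow> 'c \<times> 'd) fps" where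
  "fps_map_prod f g = Abs_fps (\<lambda>n. map_prod (f $ n) (g $ n))"

lemma fps_map_prod_nth [simp]: "fps_map_prod f g $ n = map_prod (f $ n) (g $ n)"
  by (simp add: fps_map_prod_def)

lemma sum_Pair: "(\<Sum>i\<in>I. (f i, g i)) = (sum f I, sum g I)"
  by (induction I rule: infinite_finite_induct) (simp_all add: zero_prod_def)

text \<open>Moves a pair of operator series to the power series over the direct sum, where both
  operations are plain Cauchy products.\<close>

lemma fps_extend_map_prod:
  "fps_extend (fps_map_prod f g) (fps_pair p) = fps_pair (map_prod (fps_extend f) (fps_extend g) p)"
  by (rule fps_ext) (simp add: fps_extend_nth fps_pair_def sum_Pair)

lemma fps_map_prod_comp:
  "fps_map_prod (fps_comp f f') (fps_comp g g') = fps_comp (fps_map_prod f g) (fps_map_prod f' g')"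
  by (rule fps_ext) (auto simp: fps_comp_nth sum_Pair)

text \<open>The series id + t^m D for positive m. At m = 0 the identity clause wins and D is
  dropped, hence the recurring assumption \<open>0 < m\<close>.\<close>

definition fps_id_plus :: "nat \<Rightarrow> ('a \<Rightarrow> 'a::zero) \<Rightarrow> ('a \<Rightarrow> 'a) fps" where
  "fps_id_plus m D = Abs_fps (\<lambda>n. if n = 0 then id else if n = m then D else (\<lambda>_. 0))"

lemma fps_id_plus_nth_0 [simp]: "fps_id_plus m D $ 0 = id"
  by (simp add: fps_id_plus_def)

lemma fps_map_prod_id_plus:
  "fps_map_prod (fps_id_plus m D) (fps_id_plus m D') = fps_id_plus m (map_prod D D')"
  by (rule fps_ext) (auto simp: fps_id_plus_def zero_prod_def)

lemma sum_fps_id_plus: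
  assumes "0 < m"
  shows "(\<Sum>i=0..n. (fps_id_plus m D $ i) (f i)) = f 0 + (if m \<le> n then D (f m) else 0)"
proof -
  have "(\<Sum>i=0..n. (fps_id_plus m D $ i) (f i))
      = (\<Sum>i=0..n. (if i = 0 then f 0 else 0) + (if i = m then D (f m) else 0))"
    using assms by (intro sum.cong) (auto simp: fps_id_plus_def)
  then show ?thesis by (simp add: sum.distrib)
qed

lemma fps_comp_id_plus_nth:
  assumes "0 < m"
  shows "(fps_comp (fps_id_plus m D) g $ n) x =
    (g $ n) x + (if m \<le> n then D ((g $ (n - m)) x) else 0)"
  using sum_fps_id_plus[OF assms, of D "\<lambda>i. (g $ (n - i)) x"] by (simp add: fps_comp_nth)

text \<open>A correction of order m never disturbs lower coefficients; this gives the t-adic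
  convergence of the infinite composition.\<close>

lemma fps_comp_id_plus_nth_below:
  assumes "n < m"
  shows "fps_comp (fps_id_plus m D) g $ n = g $ n"
  using assms by (intro ext) (simp add: fps_comp_id_plus_nth)

lemma (in module) fps_bilin_X_power_nth:
  "fps_bilin scale (fps_X ^ m) X $ n = (if m \<le> n then X $ (n - m) else 0)"
proof -
  have "fps_bilin scale (fps_X ^ m) X $ n = (\<Sum>i=0..n. if i = m then X $ (n - m) else 0)"
    unfolding fps_bilin_nth by (rule sum.cong) (auto simp: fps_X_power_iff)
  then show ?thesis by simp
qed

text \<open>With t^m written as a scalar of k[[t]], products of such series expand by bilinearity,
  without coefficient sums.\<close>

lemma (in module) fps_extend_id_plus:
  assumes "0 < m"
  shows "fps_extend (fps_id_plus m D) X =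
    X + fps_bilin scale (fps_X ^ m) (fps_extend (undeformed D) X)"
proof (rule fps_ext)
  fix n
  show "fps_extend (fps_id_plus m D) X $ n =
      (X + fps_bilin scale (fps_X ^ m) (fps_extend (undeformed D) X)) $ n"
    unfolding fps_extend_nth[of "fps_id_plus m D"] sum_fps_id_plus[OF assms]
    by (simp add: fps_bilin_X_power_nth fps_extend_undeformed_nth)
qed

lemma (in module) module_hom_zero: "module_hom scale scale (\<lambda>_. 0)"
  by unfold_locales simp_all

lemma (in module) module_hom_fps_id_plus:
  assumes "module_hom scale scale D"
  shows "module_hom scale scale (fps_id_plus m D $ i)"
  using assms by (simp add: fps_id_plus_def module_hom_zero module_hom_id id_def[symmetric])

section \<open>Obstructions are cocycles\<close>

text \<open>For linear r, the projection onto \<open>P\<^sub>1\<close> along the graph of r; it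
  identifies the quotient by the graph with \<open>P\<^sub>1\<close>.\<close>

definition graph_defect :: "('b \<Rightarrow> 'a::ab_group_add) \<Rightarrow> 'a \<times> 'b \<Rightarrow> 'a" where
  "graph_defect r p = fst p - r (snd p)"

text \<open>Modulo \<open>t\<^sup>m\<close> the image of \<open>E\<close> is the graph of \<open>r\<close>, which is closed under \<open>f\<close>; so only the two
  extreme terms of the Cauchy product contribute to the defect in degree \<open>m\<close>.\<close>

lemma graph_defect_leading_coefficient:
  fixes f :: "'a::ab_group_add \<times> 'b::ab_group_add \<Rightarrow> 'a \<times> 'b \<Rightarrow> 'a \<times> 'b"
    and E :: "('b \<Rightarrow> 'a \<times> 'b) fps"
  assumes add_left: "\<And>x x' y. f (x + x') y = f x y + f x' y"
    and add_right: "\<And>x y y'. f x (y + y') = f x y + f x y'"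
    and r: "additive r"
    and closed: "\<And>u v. graph_defect r (f (r u, u) (r v, v)) = 0"
    and E: "\<And>i. (E $ i) 0 = 0" "E $ 0 = (\<lambda>u. (r u, u))"
    and low: "\<And>n u. n < m \<Longrightarrow> graph_defect r ((E $ n) u) = 0"
    and m: "0 < m"
    and subalgebra: "\<exists>W. fps_bilin f (fps_extend E (fps_const u)) (fps_extend E (fps_const v)) = fps_extend E W"
  shows "graph_defect r ((E $ m) (snd (f (r u, u) (r v, v)))) =
    graph_defect r (f (r u, u) (graph_defect r ((E $ m) v), 0)) +
    graph_defect r (f (graph_defect r ((E $ m) u), 0) (r v, v))"
proof -
  interpret r: additive r by fact
  interpret d: additive "graph_defect r"
    by unfold_locales (simp add: graph_defect_def r.add)
  have split: "p = (r (snd p), snd p) + (graph_defect r p, 0)" for p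
    by (simp add: graph_defect_def prod_eq_iff)
  obtain W where W: "fps_bilin f (fps_extend E (fps_const u)) (fps_extend E (fps_const v)) = fps_extend E W"
    using subalgebra by blast
  have coeff: "(\<Sum>i=0..n. f ((E $ i) u) ((E $ (n - i)) v)) = (\<Sum>i=0..n. (E $ i) (W $ (n - i)))" for n
    using arg_cong[OF W, of "\<lambda>X. X $ n"]
    unfolding fps_bilin_nth fps_extend_const_nth[of E, OF E(1)] unfolding fps_extend_nth .
  \<comment> \<open>The second component of \<open>E $ 0\<close> is the identity, so degree 0
    determines \<open>W $ 0\<close>, the only coefficient of W that survives in the defect of degree
    m.\<close>
  have W0: "W $ 0 = snd (f (r u, u) (r v, v))"
    using coeff[of 0] by (simp add: E(2))
  have closed': "graph_defect r (f p q) = 0"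
    if "graph_defect r p = 0" "graph_defect r q = 0" for p q
    using closed[of "snd p" "snd q"] split[of p] split[of q] that by (simp add: zero_prod_def[symmetric])
  have "graph_defect r (\<Sum>i=0..m. (E $ i) (W $ (m - i)))
      = (\<Sum>i=0..m. if i = m then graph_defect r ((E $ m) (W $ 0)) else 0)"
    unfolding d.sum by (rule sum.cong) (auto simp: low)
  moreover have "graph_defect r (\<Sum>i=0..m. f ((E $ i) u) ((E $ (m - i)) v))
      = (\<Sum>i=0..m. (if i = 0 then graph_defect r (f (r u, u) ((E $ m) v)) else 0) +
                    (if i = m then graph_defect r (f ((E $ m) u) (r v, v)) else 0))"
    unfolding d.sum
  proof (rule sum.cong[OF refl])
    fix i assume "i \<in> {0..m}"
    then consider "i = 0" | "i = m" | "0 < i" "i < m" by force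
    then show "graph_defect r (f ((E $ i) u) ((E $ (m - i)) v))
      = (if i = 0 then graph_defect r (f (r u, u) ((E $ m) v)) else 0) +
        (if i = m then graph_defect r (f ((E $ m) u) (r v, v)) else 0)"
      by cases (use m in \<open>auto simp: E(2) intro!: closed' low\<close>)
  qed
  ultimately have "graph_defect r ((E $ m) (W $ 0))
      = graph_defect r (f (r u, u) ((E $ m) v)) + graph_defect r (f ((E $ m) u) (r v, v))"
    using coeff[of m] by (simp add: sum.distrib)
  \<comment> \<open>Since the graph is closed under f, multiplying by a graph element sees q only
    modulo the graph.\<close>
  moreover have "graph_defect r (f (r u, u) q) = graph_defect r (f (r u, u) (graph_defect r q, 0))" for q
    using arg_cong[OF split[of q], of "f (r u, u)"] by (simp only: add_right d.add closed add_0)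
  moreover have "graph_defect r (f q (r v, v)) = graph_defect r (f (graph_defect r q, 0) (r v, v))" for q
    using arg_cong[OF split[of q], of "\<lambda>p. f p (r v, v)"] by (simp only: add_left d.add closed add_0)
  ultimately show ?thesis by (simp add: W0)
qed


section \<open>Multiplicative power series of maps\<close>

definition fps_multiplicative :: "('p \<Rightarrow> 'p \<Rightarrow> 'p::comm_monoid_add) \<Rightarrow> ('p \<Rightarrow> 'p) fps \<Rightarrow> bool" where
  "fps_multiplicative f \<Phi> \<longleftrightarrow>
    (\<forall>X Y. fps_extend \<Phi> (fps_bilin f X Y) = fps_bilin f (fps_extend \<Phi> X) (fps_extend \<Phi> Y))"

text \<open>For bilinear f, the coefficients of t and t^2 in the condition that id + tD respects
  f.\<close>

definition square_zero_derivation :: "('p \<Rightarrow> 'p \<Rightarrow> 'p::ab_group_add) \<Rightarrow> ('p \<Rightarrow> 'p) \<Rightarrow> bool" where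
  "square_zero_derivation f D \<longleftrightarrow>
    (\<forall>p q. D (f p q) = f (D p) q + f p (D q)) \<and> (\<forall>p q. f (D p) (D q) = 0)"

lemma fps_multiplicative_comp:
  assumes "\<And>i. additive (\<Phi> $ i)" "fps_multiplicative f \<Phi>" "fps_multiplicative f \<Psi>"
  shows "fps_multiplicative f (fps_comp \<Phi> \<Psi>)"
  using assms by (simp add: fps_multiplicative_def fps_extend_comp)

lemma fps_multiplicative_id: "fps_multiplicative f (undeformed id)"
proof -
  have "fps_extend (undeformed id) X = X" for X :: "'a fps"
    by (rule fps_ext) (simp add: fps_extend_undeformed_nth)
  then show ?thesis by (simp add: fps_multiplicative_def)
qed

text \<open>The coefficient of t^n on either side involves only coefficients of the operator series
  up to n, where the limit agrees with stage n.\<close>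

lemma fps_multiplicative_limit:
  assumes "\<And>n. fps_multiplicative f (\<Phi> n)"
    and "\<And>n i. i \<le> n \<Longrightarrow> \<Phi> n $ i = \<Psi> $ i"
  shows "fps_multiplicative f \<Psi>"
  unfolding fps_multiplicative_def
proof (intro allI fps_ext)
  fix X Y n
  have eq: "fps_extend \<Psi> Z $ i = fps_extend (\<Phi> n) Z $ i" if "i \<le> n" for Z i
    unfolding fps_extend_nth using that by (intro sum.cong) (auto simp: assms(2))
  have "fps_extend \<Psi> (fps_bilin f X Y) $ n
      = fps_bilin f (fps_extend (\<Phi> n) X) (fps_extend (\<Phi> n) Y) $ n"
    using assms(1)[of n] by (simp add: eq fps_multiplicative_def)
  also have "\<dots> = fps_bilin f (fps_extend \<Psi> X) (fps_extend \<Psi> Y) $ n"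
    unfolding fps_bilin_nth by (rule sum.cong) (auto simp: eq)
  finally show "fps_extend \<Psi> (fps_bilin f X Y) $ n = fps_bilin f (fps_extend \<Psi> X) (fps_extend \<Psi> Y) $ n" .
qed

text \<open>In the expanded product the derivation rule matches the terms in t^m, and the term in
  t^(2m) vanishes because products of values of D are zero.\<close>

lemma fps_multiplicative_id_plus:
  assumes lin: "\<And>X. module_hom (fps_bilin s) (fps_bilin s) (fps_bilin f X)"
      "\<And>Y. module_hom (fps_bilin s) (fps_bilin s) (\<lambda>X. fps_bilin f X Y)"
    and s: "module s"
    and D: "additive D" "square_zero_derivation f D"
    and m: "0 < m"
  shows "fps_multiplicative f (fps_id_plus m D)"
  unfolding fps_multiplicative_def
proof (intro allI)
  fix X Y
  interpret module s by fact
  interpret M: module "fps_bilin s" by (rule module_fps)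
  interpret D: additive D by fact
  let ?D = "fps_extend (undeformed D)" and ?t = "fps_bilin s (fps_X ^ m)"
  have 1: "?D (fps_bilin f X Y) = fps_bilin f (?D X) Y + fps_bilin f X (?D Y)"
    using D(2) by (intro fps_ext)
      (simp add: fps_extend_undeformed_nth fps_bilin_nth D.sum square_zero_derivation_def sum.distrib)
  have 2: "fps_bilin f (?D X) (?D Y) = 0"
    using D(2) by (intro fps_ext)
      (simp add: fps_extend_undeformed_nth fps_bilin_nth square_zero_derivation_def)
  show "fps_extend (fps_id_plus m D) (fps_bilin f X Y)
      = fps_bilin f (fps_extend (fps_id_plus m D) X) (fps_extend (fps_id_plus m D) Y)"
    unfolding fps_extend_id_plus[OF m]
    by (simp add: module_hom.add[OF lin(1)] module_hom.add[OF lin(2)] module_hom.scale[OF lin(1)]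
        module_hom.scale[OF lin(2)] 1 2 M.scale_right_distrib add_ac)
qed

section \<open>Trivialising a formal deformation order by order\<close>

definition fps_pairing :: "('c \<Rightarrow> 'a) fps \<Rightarrow> ('c \<Rightarrow> 'b) fps \<Rightarrow> ('c \<Rightarrow> 'a \<times> 'b) fps" where
  "fps_pairing f g = Abs_fps (\<lambda>n u. ((f $ n) u, (g $ n) u))"

lemma fps_pairing_nth: "(fps_pairing f g $ n) u = ((f $ n) u, (g $ n) u)"
  by (simp add: fps_pairing_def)

lemma fps_extend_pairing:
  "fps_extend (fps_pairing f g) U = fps_pair (fps_extend f U, fps_extend g U)"
  by (rule fps_ext) (simp add: fps_extend_nth fps_pairing_nth fps_pair_def sum_Pair)

lemma additive_if_module_hom: "module_hom s s' f \<Longrightarrow> additive f"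
  by unfold_locales (rule module_hom.add)

text \<open>The scalar c is one half, expressed without division because the scalars form only a
  commutative ring.\<close>

lemma (in poisson_algebra) square_zero_derivation_if_endomorphisms:
  assumes two: "c + c = (1 :: 'k)"
    and endo: "\<And>t. poisson_endomorphism (\<lambda>p. p + scale t (D p))"
  shows "module_hom scale scale D" "square_zero_derivation mult D" "square_zero_derivation brk D"
proof -
  have lin: "module_hom scale scale (\<lambda>p. p + D p)"
    using endo[of 1] by (simp add: poisson_endomorphism_def)
  show "module_hom scale scale D"
  proof unfold_locales
    show "D (x + y) = D x + D y" for x y
      using module_hom.add[OF lin, of x y] by (simp add: algebra_simps)
    show "D (scale a x) = scale a (D x)" for a x
      using module_hom.scale[OF lin, of a x] by (simp add: scale_right_distrib)
  qed
  have gen: "square_zero_derivation f D"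
    if f: "\<And>x. module_hom scale scale (f x)" "\<And>y. module_hom scale scale (\<lambda>x. f x y)"
      and hom: "\<And>t p q. f p q + scale t (D (f p q)) = f (p + scale t (D p)) (q + scale t (D q))"
    for f
    unfolding square_zero_derivation_def
  proof (intro conjI allI)
    fix p q
    let ?L = "D (f p q) - (f (D p) q + f p (D q))" and ?Z = "f (D p) (D q)"
    have expand: "scale t (D (f p q)) = scale t (f (D p) q + f p (D q)) + scale (t * t) ?Z" for t
      using hom[of p q t]
      by (simp add: module_hom.add[OF f(1)] module_hom.add[OF f(2)] module_hom.scale[OF f(1)]
          module_hom.scale[OF f(2)] scale_right_distrib add_ac)
    \<comment> \<open>Between t = 1 and t = -1 the linear term changes sign and the quadratic one
      does not. Adding the two equations gives twice \<open>?Z\<close> equal to 0, and one half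
      removes the factor.\<close>
    have "?L = ?Z" "- ?L = ?Z"
      using expand[of 1] expand[of "- 1"] by (simp_all add: algebra_simps)
    then have "?Z + ?Z = 0" by (metis add.right_inverse)
    then have "scale (c + c) ?Z = 0"
      by (simp only: scale_left_distrib scale_right_distrib[symmetric] scale_zero_right)
    then show "?Z = 0" by (simp add: two)
    with \<open>?L = ?Z\<close> show "D (f p q) = f (D p) q + f p (D q)" by simp
  qed
  show "square_zero_derivation mult D" "square_zero_derivation brk D"
    using endo by (auto intro!: gen mult_linear_left mult_linear_right brk_linear_left
        brk_linear_right simp: poisson_endomorphism_def)
qed

context proto_twilled_poisson
begin

text \<open>The induction invariant: multiplicativity holds to all orders and only the intertwining
  of \<open>rt\<close> with r is truncated, so a step has to repair just the coefficient of degree N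
  + 1.\<close>

definition trivializing_upto ::
    "('b \<Rightarrow> 'a) \<Rightarrow> ('b \<Rightarrow> 'a) fps \<Rightarrow> nat \<Rightarrow> ('a \<Rightarrow> 'a) fps \<Rightarrow> ('b \<Rightarrow> 'b) fps \<Rightarrow> bool" where
  "trivializing_upto r rt N \<phi>1 \<phi>2 \<longleftrightarrow>
     (\<forall>i. module_hom s1 s1 (\<phi>1 $ i)) \<and> (\<forall>i. module_hom s2 s2 (\<phi>2 $ i)) \<and>
     \<phi>1 $ 0 = id \<and> \<phi>2 $ 0 = id \<and>
     fps_multiplicative mult (fps_map_prod \<phi>1 \<phi>2) \<and>
     fps_multiplicative brk (fps_map_prod \<phi>1 \<phi>2) \<and>
     (\<forall>n\<le>N. fps_comp \<phi>1 rt $ n = r \<circ> \<phi>2 $ n)"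

section \<open>The graph of r as a subalgebra and its action on the quotient\<close>

lemma module_hom_map_prod:
  assumes "module_hom s1 s1 f" "module_hom s2 s2 g"
  shows "module_hom (prod_scale s1 s2) (prod_scale s1 s2) (map_prod f g)"
  using assms module_axioms
  by (auto simp: module_hom_def module_hom_axioms_def prod_scale_def)

lemma module_hom_map_prodD:
  assumes "module_hom (prod_scale s1 s2) (prod_scale s1 s2) (map_prod f g)"
  shows "module_hom s1 s1 f" "module_hom s2 s2 g"
proof -
  interpret module_hom "prod_scale s1 s2" "prod_scale s1 s2" "map_prod f g" by fact
  show "module_hom s1 s1 f"
  proof unfold_locales
    show "f (x + y) = f x + f y" for x y using add[of "(x, 0)" "(y, 0)"] by simp
    show "f (s1 c x) = s1 c (f x)" for c x
      using scale[of c "(x, 0)"] by (simp add: prod_scale_def)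
  qed
  show "module_hom s2 s2 g"
  proof unfold_locales
    show "g (x + y) = g x + g y" for x y using add[of "(0, x)" "(0, y)"] by simp
    show "g (s2 c x) = s2 c (g x)" for c x
      using scale[of c "(0, x)"] by (simp add: prod_scale_def)
  qed
qed

text \<open>The graph of a linear map is a subspace, and membership in it is vanishing of the
  defect; only the two closure conditions remain.\<close>

lemma deformation_map_iff:
  "deformation_map r \<longleftrightarrow> module_hom s2 s1 r \<and>
    (\<forall>u v. graph_defect r (mult (r u, u) (r v, v)) = 0) \<and>
    (\<forall>u v. graph_defect r (brk (r u, u) (r v, v)) = 0)"
proof -
  have "subspace {(r u, u) | u. True}" if "module_hom s2 s1 r"
  proof -
    interpret r: module_hom s2 s1 r by fact
    show ?thesis
      by (auto simp: subspace_def prod_scale_def zero_prod_def r.add r.scale r.zero)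
  qed
  moreover have "p \<in> {(r u, u) | u. True} \<longleftrightarrow> graph_defect r p = 0" for p
    by (cases p) (auto simp: graph_defect_def)
  ultimately show ?thesis
    unfolding deformation_map_def poisson_subalgebra_def
    by (auto simp del: mem_Collect_eq)
qed

text \<open>The operations of \<open>(P\<^sub>2)\<^sub>r\<close> are those of the graph, transported
  along u \<mapsto> (r u, u).\<close>

lemma dot_r_eq: "dot_r r u v = snd (mult (r u, u) (r v, v))"
  by (simp add: dot_r_def mult_components)

lemma brk_r_eq: "brk_r r u v = snd (brk (r u, u) (r v, v))"
  by (simp add: brk_r_def brk_components)

lemma zero_components:
  "\<nu> 0 x = 0" "\<theta> u 0 = 0" "dot2 u 0 = 0" "\<mu> x 0 = 0"
  "\<psi> 0 x = 0" "\<Theta> u 0 = 0" "brk2 u 0 = 0" "\<rho> x 0 = 0"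
  using module_hom.zero[OF mult_linear_left] module_hom.zero[OF mult_linear_right]
    module_hom.zero[OF brk_linear_left] module_hom.zero[OF brk_linear_right]
  by (simp_all add: \<nu>_def \<theta>_def dot2_def \<mu>_def \<psi>_def \<Theta>_def brk2_def \<rho>_def zero_prod_def)

text \<open>The representation on \<open>P\<^sub>1\<close> is the action of the graph on the
  quotient by itself; in this form the leading-coefficient identity becomes the cocycle
  condition.\<close>

lemma \<nu>_r_eq: "\<nu>_r r u x = graph_defect r (mult (r u, u) (x, 0))"
  by (simp add: \<nu>_r_def graph_defect_def mult_components zero_components add_ac)

lemma \<psi>_r_eq: "\<psi>_r r u x = graph_defect r (brk (r u, u) (x, 0))"
  by (simp add: \<psi>_r_def graph_defect_def brk_components zero_components add_ac)

section \<open>The induction: obstruction and correction in degree N + 1\<close>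

lemma trivializing_upto_id:
  assumes "rt $ 0 = r"
  shows "trivializing_upto r rt 0 (undeformed id) (undeformed id)"
proof -
  have "fps_map_prod (undeformed id) (undeformed id) = undeformed (id :: 'a \<times> 'b \<Rightarrow> _)"
    by (rule fps_ext) (auto simp: undeformed_def zero_prod_def)
  then show ?thesis
    using assms P1.module_hom_zero P2.module_hom_zero P1.module_hom_id P2.module_hom_id
    by (simp add: trivializing_upto_def fps_multiplicative_id fps_comp_nth_0)
      (simp add: undeformed_def id_def comp_def)
qed

lemma obstruction_in_Z1:
  assumes def: "deformation_map r" and fd: "formal_deformation r rt"
    and triv: "trivializing_upto r rt N \<phi>1 \<phi>2"
  shows "(\<lambda>u. (fps_comp \<phi>1 rt $ Suc N) u - r ((\<phi>2 $ Suc N) u)) \<in> Z1 r"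
proof -
  define a where "a = fps_comp \<phi>1 rt"
  \<comment> \<open>E parametrises the image of the graph of \<open>rt\<close> under the
    homomorphism; it lies in the graph of r up to degree N.\<close>
  define E where "E = fps_pairing a \<phi>2"
  interpret FT: proto_twilled_poisson "fps_bilin s1" "fps_bilin s2" "fps_prod_bilin mult" "fps_prod_bilin brk"
    by (rule proto_twilled_poisson_fps) (rule proto_twilled_poisson_axioms)
  have hom: "module_hom s1 s1 (\<phi>1 $ i)" "module_hom s2 s2 (\<phi>2 $ i)" "module_hom s2 s1 (rt $ i)"
      "module_hom s2 s1 r" for i
    using fd triv def
    by (simp_all add: formal_deformation_def trivializing_upto_def deformation_map_iff)
  have hom_a: "module_hom s2 s1 (a $ i)" for i
    unfolding a_def using hom by (intro module_hom_fps_comp)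
  have Eu: "fps_extend E U = fps_extend (fps_map_prod \<phi>1 \<phi>2) (fps_pair (fps_extend rt U, U))" for U
    by (simp add: E_def a_def fps_extend_pairing fps_extend_map_prod
        fps_extend_comp[OF additive_if_module_hom[OF hom(1)]])
  \<comment> \<open>A multiplicative map sends the graph of \<open>rt\<close>, closed under f, to a
    set closed under f; W is the second component of the product taken before mapping.\<close>
  have subalgebra: "\<exists>W. fps_bilin f (fps_extend E U) (fps_extend E V) = fps_extend E W"
    if f: "fps_multiplicative f (fps_map_prod \<phi>1 \<phi>2)"
      "graph_defect (fps_extend rt) (fps_prod_bilin f (fps_extend rt U, U) (fps_extend rt V, V)) = 0"
    for f U V
  proof -
    obtain W where "fps_prod_bilin f (fps_extend rt U, U) (fps_extend rt V, V) = (fps_extend rt W, W)"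
      using f(2) by (metis graph_defect_def eq_iff_diff_eq_0 prod.collapse)
    then have "fps_bilin f (fps_pair (fps_extend rt U, U)) (fps_pair (fps_extend rt V, V))
        = fps_pair (fps_extend rt W, W)"
      by (metis fps_pair_prod_bilin)
    then show ?thesis
      using f(1) unfolding Eu fps_multiplicative_def by metis
  qed
  have leading: "graph_defect r ((E $ Suc N) (snd (f (r u, u) (r v, v)))) =
      graph_defect r (f (r u, u) (graph_defect r ((E $ Suc N) v), 0)) +
      graph_defect r (f (graph_defect r ((E $ Suc N) u), 0) (r v, v))"
    if f: "f = mult \<or> f = brk" for f u v
  proof (rule graph_defect_leading_coefficient)
    show "f (x + x') y = f x y + f x' y" "f x (y + y') = f x y + f x y'" for x x' y y'
      using f module_hom.add[OF mult_linear_left] module_hom.add[OF mult_linear_right]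
        module_hom.add[OF brk_linear_left] module_hom.add[OF brk_linear_right] by blast+
    show "additive r" by (rule additive_if_module_hom) (rule hom)
    show "graph_defect r (f (r u, u) (r v, v)) = 0" for u v
      using f def by (auto simp: deformation_map_iff)
    show "(E $ i) 0 = 0" for i
      using module_hom.zero[OF hom(2)] module_hom.zero[OF hom_a]
      by (simp add: E_def fps_pairing_nth zero_prod_def)
    show "E $ 0 = (\<lambda>u. (r u, u))"
      using triv fd
      by (auto simp: E_def a_def fps_pairing_nth fps_comp_nth_0 trivializing_upto_def
          formal_deformation_def)
    show "graph_defect r ((E $ n) u) = 0" if "n < Suc N" for n u
      using triv that
      by (simp add: graph_defect_def E_def a_def fps_pairing_nth trivializing_upto_def)
    show "\<exists>W. fps_bilin f (fps_extend E (fps_const u)) (fps_extend E (fps_const v)) = fps_extend E W"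
      using f triv fd
      by (intro subalgebra)
        (auto simp: trivializing_upto_def formal_deformation_def FT.deformation_map_iff)
  qed simp
  define c where "c u = graph_defect r ((E $ Suc N) u)" for u
  have c_eq: "c u = (fps_comp \<phi>1 rt $ Suc N) u - r ((\<phi>2 $ Suc N) u)" for u
    by (simp add: c_def E_def a_def graph_defect_def fps_pairing_nth)
  have "module_hom s2 s1 c"
  proof unfold_locales
    show "c (u + v) = c u + c v" for u v
      unfolding c_eq a_def[symmetric]
      by (simp add: module_hom.add[OF hom_a] module_hom.add[OF hom(2)] module_hom.add[OF hom(4)])
    show "c (s2 k u) = s1 k (c u)" for k u
      unfolding c_eq a_def[symmetric]
      by (simp add: module_hom.scale[OF hom_a] module_hom.scale[OF hom(2)]
          module_hom.scale[OF hom(4)] P1.scale_right_diff_distrib)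
  qed
  moreover have "c (dot_r r u v) = \<nu>_r r u (c v) + \<nu>_r r v (c u)" for u v
    using leading[of mult u v] mult_commute[of "(c u, 0)" "(r v, v)"]
    by (simp add: dot_r_eq \<nu>_r_eq c_def[symmetric])
  \<comment> \<open>The second leading term has \<open>(c u, 0)\<close> on the left, the opposite
    order to \<open>\<psi>_r\<close>; swapping produces the minus sign.\<close>
  moreover have "c (brk_r r u v) = \<psi>_r r u (c v) - \<psi>_r r v (c u)" for u v
  proof -
    have "graph_defect r (- p) = - graph_defect r p" for p
      by (simp add: graph_defect_def module_hom.neg[OF hom(4)])
    then show ?thesis
      using leading[of brk u v] brk_antisym[of "(c u, 0)" "(r v, v)"]
      by (simp add: brk_r_eq \<psi>_r_eq c_def[symmetric])
  qed
  ultimately have "c \<in> Z1 r" by (simp add: Z1_def)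
  then show ?thesis by (simp add: c_eq[abs_def])
qed

text \<open>The maps in the definition of \<open>Nij\<close> are id + tD with D the direct sum of
  the two maps here, so evaluation at t = 1 and t = -1 applies.\<close>

lemma Nij_square_zero_derivation:
  assumes two: "c + c = (1 :: 'k)" and "x0 \<in> Nij r"
  shows "module_hom s1 s1 (brk1 x0)" "module_hom s2 s2 (\<lambda>u. \<rho> x0 u + H x0 (r u))"
    "square_zero_derivation mult (map_prod (brk1 x0) (\<lambda>u. \<rho> x0 u + H x0 (r u)))"
    "square_zero_derivation brk (map_prod (brk1 x0) (\<lambda>u. \<rho> x0 u + H x0 (r u)))"
proof -
  have "poisson_endomorphism
      (\<lambda>p. p + prod_scale s1 s2 t (map_prod (brk1 x0) (\<lambda>u. \<rho> x0 u + H x0 (r u)) p))" for t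
    using assms(2) by (simp add: Nij_def prod_scale_def case_prod_unfold plus_prod_def map_prod_def)
  note D = square_zero_derivation_if_endomorphisms[OF two this]
  show "module_hom s1 s1 (brk1 x0)" "module_hom s2 s2 (\<lambda>u. \<rho> x0 u + H x0 (r u))"
    by (rule module_hom_map_prodD[OF D(1)])+
  show "square_zero_derivation mult (map_prod (brk1 x0) (\<lambda>u. \<rho> x0 u + H x0 (r u)))"
    "square_zero_derivation brk (map_prod (brk1 x0) (\<lambda>u. \<rho> x0 u + H x0 (r u)))"
    by (rule D)+
qed

lemma H_antisym: "H x y = - H y x" and brk1_antisym: "brk1 x y = - brk1 y x"
  using brk_antisym[of "(x, 0)" "(y, 0)"] by (simp_all add: H_def brk1_def)

lemma trivializing_upto_Suc:
  assumes two: "c + c = (1 :: 'k)"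
    and \<psi>0: "\<forall>u x. \<psi> u x = 0"
    and def: "deformation_map r" and fd: "formal_deformation r rt"
    and Z1: "Z1 r \<subseteq> \<delta>_FGV r ` Nij r"
    and triv: "trivializing_upto r rt N \<phi>1 \<phi>2"
  shows "\<exists>x0. trivializing_upto r rt (Suc N)
    (fps_comp (fps_id_plus (Suc N) (brk1 x0)) \<phi>1)
    (fps_comp (fps_id_plus (Suc N) (\<lambda>u. \<rho> x0 u + H x0 (r u))) \<phi>2)"
proof -
  obtain x0 where x0: "x0 \<in> Nij r"
    and \<delta>: "\<And>u. (fps_comp \<phi>1 rt $ Suc N) u - r ((\<phi>2 $ Suc N) u) = \<psi>_r r u x0"
    using obstruction_in_Z1[OF def fd triv] Z1 by (auto simp: \<delta>_FGV_def fun_eq_iff)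
  define D1 D2 where "D1 = brk1 x0" and "D2 = (\<lambda>u. \<rho> x0 u + H x0 (r u))"
  note D = Nij_square_zero_derivation[OF two x0, folded D1_def D2_def]
  let ?e1 = "fps_id_plus (Suc N) D1" and ?e2 = "fps_id_plus (Suc N) D2"
  interpret F: poisson_algebra "fps_bilin (prod_scale s1 s2)" "fps_bilin mult" "fps_bilin brk"
    by (rule poisson_algebra_fps) (rule poisson_algebra_axioms)
  interpret r: module_hom s2 s1 r using def by (simp add: deformation_map_def)
  have hom: "module_hom s1 s1 (\<phi>1 $ i)" "module_hom s2 s2 (\<phi>2 $ i)"
      "module_hom s1 s1 (?e1 $ i)" "module_hom s2 s2 (?e2 $ i)" for i
    using triv D(1,2)
    by (simp_all add: trivializing_upto_def P1.module_hom_fps_id_plus P2.module_hom_fps_id_plus)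
  have Dadd: "additive (map_prod D1 D2)"
    by (rule additive_if_module_hom) (rule module_hom_map_prod[OF D(1,2)])
  have eadd: "additive (fps_map_prod ?e1 ?e2 $ i)" for i
    unfolding fps_map_prod_nth by (rule additive_if_module_hom) (rule module_hom_map_prod[OF hom(3,4)])
  have "fps_multiplicative mult (fps_map_prod ?e1 ?e2)" "fps_multiplicative brk (fps_map_prod ?e1 ?e2)"
    unfolding fps_map_prod_id_plus
    by (rule fps_multiplicative_id_plus[OF F.mult_linear_right F.mult_linear_left module_axioms Dadd D(3)]
        fps_multiplicative_id_plus[OF F.brk_linear_right F.brk_linear_left module_axioms Dadd D(4)];
        simp)+
  then have mult: "fps_multiplicative mult (fps_map_prod (fps_comp ?e1 \<phi>1) (fps_comp ?e2 \<phi>2))"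
    "fps_multiplicative brk (fps_map_prod (fps_comp ?e1 \<phi>1) (fps_comp ?e2 \<phi>2))"
    using triv unfolding fps_map_prod_comp trivializing_upto_def
    by (auto intro!: fps_multiplicative_comp eadd)
  have assoc: "fps_comp (fps_comp ?e1 \<phi>1) rt = fps_comp ?e1 (fps_comp \<phi>1 rt)"
    by (rule fps_comp_assoc) (rule additive_if_module_hom[OF hom(3)])
  have zero: "\<phi>1 $ 0 = id" "\<phi>2 $ 0 = id" "rt $ 0 = r"
    using triv fd by (simp_all add: trivializing_upto_def formal_deformation_def)
  have "fps_comp (fps_comp ?e1 \<phi>1) rt $ n = r \<circ> fps_comp ?e2 \<phi>2 $ n" if "n \<le> Suc N" for n
  proof (cases "n = Suc N")
    case False
    then have "n < Suc N" using that by simp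
    then show ?thesis
      using triv by (simp add: assoc fps_comp_id_plus_nth_below trivializing_upto_def)
  next
    case True
    show ?thesis
    proof
      fix u
      \<comment> \<open>As \<psi> = 0, antisymmetry of the remaining bracket terms turns the
        coboundary into the failure of r to commute with D.\<close>
      have "\<psi>_r r u x0 = r (D2 u) - D1 (r u)"
        using H_antisym[of "r u" x0] brk1_antisym[of "r u" x0]
        by (simp add: \<psi>_r_def \<psi>0 D1_def D2_def r.add r.neg r.diff)
      then have "(fps_comp \<phi>1 rt $ Suc N) u + D1 (r u) = r ((\<phi>2 $ Suc N) u + D2 u)"
        using \<delta>[of u] by (simp add: r.add algebra_simps)
      \<comment> \<open>In degree N + 1 the new factor adds D applied to the degree 0 coefficients,
        which are r on the left and the identity on the right.\<close>
      then show "(fps_comp (fps_comp ?e1 \<phi>1) rt $ n) u = (r \<circ> fps_comp ?e2 \<phi>2 $ n) u"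
        by (simp add: assoc True fps_comp_id_plus_nth fps_comp_nth_0 zero)
    qed
  qed
  then have "trivializing_upto r rt (Suc N) (fps_comp ?e1 \<phi>1) (fps_comp ?e2 \<phi>2)"
    unfolding trivializing_upto_def
    using mult hom by (auto intro!: module_hom_fps_comp simp: fps_comp_nth_0 zero)
  then show ?thesis unfolding D1_def D2_def by blast
qed


section \<open>The homomorphism over k[[t]] as a t-adic limit\<close>

lemma poisson_endomorphism_fps:
  assumes hom: "\<And>i. module_hom s1 s1 (\<phi>1 $ i)" "\<And>i. module_hom s2 s2 (\<phi>2 $ i)"
    and "fps_multiplicative mult (fps_map_prod \<phi>1 \<phi>2)"
    and "fps_multiplicative brk (fps_map_prod \<phi>1 \<phi>2)"
  shows "poisson_algebra.poisson_endomorphism (prod_scale (fps_bilin s1) (fps_bilin s2))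
    (fps_prod_bilin mult) (fps_prod_bilin brk) (map_prod (fps_extend \<phi>1) (fps_extend \<phi>2))"
proof -
  interpret FT: proto_twilled_poisson "fps_bilin s1" "fps_bilin s2" "fps_prod_bilin mult" "fps_prod_bilin brk"
    by (rule proto_twilled_poisson_fps) (rule proto_twilled_poisson_axioms)
  have "map_prod (fps_extend \<phi>1) (fps_extend \<phi>2) (fps_prod_bilin f p q) =
      fps_prod_bilin f (map_prod (fps_extend \<phi>1) (fps_extend \<phi>2) p) (map_prod (fps_extend \<phi>1) (fps_extend \<phi>2) q)"
    if "fps_multiplicative f (fps_map_prod \<phi>1 \<phi>2)" for f p q
    using that unfolding fps_pair_inj fps_pair_prod_bilin fps_extend_map_prod[symmetric]
    by (simp add: fps_multiplicative_def)
  then show ?thesis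
    using assms by (simp add: FT.poisson_endomorphism_def FT.module_hom_map_prod module_hom_fps_extend)
qed

text \<open>The constant series acts coefficientwise, so every coefficient of a product of graph
  elements is a sum of products taken in the graph of r.\<close>

lemma deformation_map_undeformed:
  assumes "deformation_map r"
  shows "proto_twilled_poisson.deformation_map (fps_bilin s1) (fps_bilin s2)
    (fps_prod_bilin mult) (fps_prod_bilin brk) (fps_extend (undeformed r))"
proof -
  interpret FT: proto_twilled_poisson "fps_bilin s1" "fps_bilin s2" "fps_prod_bilin mult" "fps_prod_bilin brk"
    by (rule proto_twilled_poisson_fps) (rule proto_twilled_poisson_axioms)
  interpret r: module_hom s2 s1 r using assms by (simp add: deformation_map_def)
  let ?r = "fps_extend (undeformed r)"
  have "module_hom s2 s1 (undeformed r $ i)" for i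
    by unfold_locales (simp_all add: undeformed_def r.add r.scale)
  then have lin: "module_hom (fps_bilin s2) (fps_bilin s1) ?r"
    by (rule module_hom_fps_extend)
  have "graph_defect ?r (fps_prod_bilin f (?r U, U) (?r V, V)) = 0"
    if "\<And>u v. graph_defect r (f (r u, u) (r v, v)) = 0" for f U V
  proof (rule fps_ext)
    fix n
    have "additive (graph_defect r)"
      by unfold_locales (simp add: graph_defect_def r.add)
    then have "graph_defect r (\<Sum>i=0..n. f (r (U $ i), U $ i) (r (V $ (n - i)), V $ (n - i))) = 0"
      by (simp add: additive.sum that)
    then show "graph_defect ?r (fps_prod_bilin f (?r U, U) (?r V, V)) $ n = 0 $ n"
      by (simp add: graph_defect_def fps_prod_bilin_def fps_unpair_def fps_bilin_nth
          fps_extend_undeformed_nth fps_pair_def)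
  qed
  then show ?thesis
    using assms by (simp add: FT.deformation_map_iff deformation_map_iff lin)
qed

lemma rigid_if_Z1_subset:
  assumes two: "c + c = (1 :: 'k)"
    and \<psi>0: "\<forall>u x. \<psi> u x = 0"
    and def: "deformation_map r"
    and Z1: "Z1 r \<subseteq> \<delta>_FGV r ` Nij r"
  shows "rigid r"
  unfolding rigid_def
proof (intro allI impI)
  fix rt assume fd: "formal_deformation r rt"
  interpret FT: proto_twilled_poisson "fps_bilin s1" "fps_bilin s2" "fps_prod_bilin mult" "fps_prod_bilin brk"
    by (rule proto_twilled_poisson_fps) (rule proto_twilled_poisson_axioms)
  define start where "start = (undeformed (id :: 'a \<Rightarrow> 'a), undeformed (id :: 'b \<Rightarrow> 'b))"
  define next_step where "next_step N x0 \<phi> =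
    (fps_comp (fps_id_plus (Suc N) (brk1 x0)) (fst \<phi>),
     fps_comp (fps_id_plus (Suc N) (\<lambda>u. \<rho> x0 u + H x0 (r u))) (snd \<phi>))" for N x0 and \<phi> :: "('a \<Rightarrow> 'a) fps \<times> ('b \<Rightarrow> 'b) fps"
  \<comment> \<open>The choice records the start and the form of each step as well as the invariant:
    they are needed for convergence and for the linear term.\<close>
  have "\<exists>f. \<forall>N :: nat. (trivializing_upto r rt N (fst (f N)) (snd (f N)) \<and> (N = 0 \<longrightarrow> f N = start)) \<and>
      (\<exists>x0. f (Suc N) = next_step N x0 (f N))"
  proof (rule dependent_nat_choice)
    show "\<exists>\<phi>. trivializing_upto r rt 0 (fst \<phi>) (snd \<phi>) \<and> (0 = 0 \<longrightarrow> \<phi> = start)"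
      using trivializing_upto_id[of rt r] fd by (auto simp: start_def formal_deformation_def)
    show "\<exists>\<phi>'. (trivializing_upto r rt (Suc N) (fst \<phi>') (snd \<phi>') \<and> (Suc N = 0 \<longrightarrow> \<phi>' = start)) \<and>
        (\<exists>x0. \<phi>' = next_step N x0 \<phi>)"
      if "trivializing_upto r rt N (fst \<phi>) (snd \<phi>) \<and> (N = 0 \<longrightarrow> \<phi> = start)" for \<phi> N
      using trivializing_upto_Suc[OF two \<psi>0 def fd Z1, of N "fst \<phi>" "snd \<phi>"] that
      by (fastforce simp: next_step_def)
  qed
  then obtain f where triv: "\<And>N. trivializing_upto r rt N (fst (f N)) (snd (f N))"
    and start: "f 0 = start" and step: "\<And>N. \<exists>x0. f (Suc N) = next_step N x0 (f N)"
    by blast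
  \<comment> \<open>Diagonal limit: step N has order N + 1, so the coefficient of degree n is final
    from stage n on.\<close>
  define \<phi>1 where "\<phi>1 = Abs_fps (\<lambda>n. fst (f n) $ n)"
  define \<phi>2 where "\<phi>2 = Abs_fps (\<lambda>n. snd (f n) $ n)"
  have stable: "fst (f N) $ n = \<phi>1 $ n \<and> snd (f N) $ n = \<phi>2 $ n" if "n \<le> N" for n N
    using that
  proof (induction rule: dec_induct)
    case base
    then show ?case by (simp add: \<phi>1_def \<phi>2_def)
  next
    case (step k)
    then show ?case
      using \<open>\<And>N. \<exists>x0. f (Suc N) = next_step N x0 (f N)\<close>[of k]
      by (auto simp: next_step_def fps_comp_id_plus_nth_below)
  qed
  have hom: "module_hom s1 s1 (\<phi>1 $ i)" "module_hom s2 s2 (\<phi>2 $ i)" for i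
    using triv[of i] by (simp_all add: \<phi>1_def \<phi>2_def trivializing_upto_def)
  have zero: "\<phi>1 $ 0 = id" "\<phi>2 $ 0 = id"
    using triv[of 0] by (simp_all add: \<phi>1_def \<phi>2_def trivializing_upto_def)
  \<comment> \<open>The step from stage 0 composes id + tD with the identity and all later steps
    have order at least 2, so its element x0 gives the linear terms required by equivalence.\<close>
  obtain x0 where "f (Suc 0) = next_step 0 x0 (f 0)" using step by blast
  then have one: "\<phi>1 $ 1 = (\<lambda>x. brk1 x0 x)" "\<phi>2 $ 1 = (\<lambda>u. \<rho> x0 u + H x0 (r u))"
    by (auto simp: \<phi>1_def \<phi>2_def start start_def next_step_def fps_comp_id_plus_nth undeformed_def fun_eq_iff)
  have mult: "fps_multiplicative mult (fps_map_prod \<phi>1 \<phi>2)" "fps_multiplicative brk (fps_map_prod \<phi>1 \<phi>2)"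
    by (rule fps_multiplicative_limit[where \<Phi> = "\<lambda>n. fps_map_prod (fst (f n)) (snd (f n))"];
        use triv in \<open>simp add: trivializing_upto_def stable\<close>)+
  have "fps_comp \<phi>1 rt = fps_comp (undeformed r) \<phi>2"
  proof (intro fps_ext ext)
    fix n u
    have "(fps_comp \<phi>1 rt $ n) u = (fps_comp (fst (f n)) rt $ n) u"
      by (simp add: fps_comp_nth stable)
    also have "\<dots> = r ((\<phi>2 $ n) u)"
      using triv[of n] stable[of n n] by (simp add: trivializing_upto_def)
    also have "\<dots> = (fps_comp (undeformed r) \<phi>2 $ n) u"
      by (simp add: fps_comp_eq_extend fps_extend_undeformed_nth)
    finally show "(fps_comp \<phi>1 rt $ n) u = (fps_comp (undeformed r) \<phi>2 $ n) u" .
  qed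
  moreover have "additive (undeformed r $ i)" for i
    using def
    by (auto simp: undeformed_def deformation_map_def additive_def dest: module_hom.add)
  ultimately have comm: "fps_extend \<phi>1 \<circ> fps_extend rt = fps_extend (undeformed r) \<circ> fps_extend \<phi>2"
    using fps_extend_comp[of \<phi>1 rt] fps_extend_comp[of "undeformed r" \<phi>2]
      additive_if_module_hom[OF hom(1)] by (auto simp: fun_eq_iff)
  have "FT.deformation_map_hom (fps_extend rt) (fps_extend (undeformed r)) (fps_extend \<phi>1) (fps_extend \<phi>2)"
    unfolding FT.deformation_map_hom_def
    using fd deformation_map_undeformed[OF def] module_hom_fps_extend[OF hom(1)]
      module_hom_fps_extend[OF hom(2)] poisson_endomorphism_fps[OF hom mult] comm
    by (auto simp: formal_deformation_def)
  then show "equivalent_deformations r rt (undeformed r)"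
    unfolding equivalent_deformations_def using zero one hom by blast
qed

end

theorem theorem7p6:
  fixes s1 :: "'k::field_char_0 \<Rightarrow> 'a::ab_group_add \<Rightarrow> 'a"
    and s2 :: "'k \<Rightarrow> 'b::ab_group_add \<Rightarrow> 'b"
    and mult brk :: "'a \<times> 'b \<Rightarrow> 'a \<times> 'b \<Rightarrow> 'a \<times> 'b"
    and r :: "'b \<Rightarrow> 'a"
  assumes "proto_twilled_poisson s1 s2 mult brk"
    and "\<forall>u x. proto_twilled_poisson.\<psi> brk u x = 0"
    and "proto_twilled_poisson.deformation_map s1 s2 mult brk r"
    and "proto_twilled_poisson.Z1 s1 s2 mult brk r =
         proto_twilled_poisson.\<delta>_FGV brk r ` proto_twilled_poisson.Nij s1 s2 mult brk r"
  shows "proto_twilled_poisson.rigid s1 s2 mult brk r"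
proof -
  interpret proto_twilled_poisson s1 s2 mult brk by fact
  \<comment> \<open>Characteristic 0 provides the half with which the quadratic terms were shown to
    vanish.\<close>
  have "1 / 2 + 1 / 2 = (1 :: 'k)" by simp
  then show ?thesis
    using assms(2-4) by (rule rigid_if_Z1_subset[OF _ _ _ equalityD1])
qed

end
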